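(* Let $R$ be a commutative Noetherian ring and $M$ a finitely generated $R$-module. For any ideal $I$ of $R$, we have $r(r(I,M),M)=r(I,M)$.
   Context: For submodules $A,B$ of $M$, $(A:B)=\{x\in R : xB\subseteq A\}$. For an ideal $I$ of $R$, $r(I,M)=\bigcup_{k\geq 1}(I^{k+1}M:I^kM)$; this is the union of an ascending chain of ideals of $R$, hence an ideal of $R$ (the Ratliff-Rush ideal associated with $I$ and $M$). *)

theory Defs
  imports "HOL-Algebra.Algebra"
begin

definition gen_submodule ::
  "('a, 'm) ring_scheme \<Rightarrow> ('a, 'b, 'c) module_scheme \<Rightarrow> 'b set \<Rightarrow> 'b set"
  where "gen_submodule R M S = \<Inter> {N. submodule N R M \<and> S \<subseteq> N}"

definition finitely_generated_module ::
  "('a, 'm) ring_scheme \<Rightarrow> ('a, 'b, 'c) module_scheme \<Rightarrow> bool"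
  where "finitely_generated_module R M \<longleftrightarrow>
    (\<exists>S \<subseteq> carrier M. finite S \<and> carrier M = gen_submodule R M S)"

(* The submodule I N, i.e. all finite sums of products a x with a in I and x in N. *)
definition ideal_smult ::
  "('a, 'm) ring_scheme \<Rightarrow> ('a, 'b, 'c) module_scheme \<Rightarrow> 'a set \<Rightarrow> 'b set \<Rightarrow> 'b set"
  where "ideal_smult R M I N = gen_submodule R M {a \<odot>\<^bsub>M\<^esub> x | a x. a \<in> I \<and> x \<in> N}"

definition colon ::
  "('a, 'm) ring_scheme \<Rightarrow> ('a, 'b, 'c) module_scheme \<Rightarrow> 'b set \<Rightarrow> 'b set \<Rightarrow> 'a set"
  where "colon R M A B = {x \<in> carrier R. (\<lambda>b. x \<odot>\<^bsub>M\<^esub> b) ` B \<subseteq> A}"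

(* The k-th power of the ideal I is its power in the multiplicative monoid of ideals,
   so that the zeroth power is the whole ring. *)
definition ratliff_rush ::
  "('a, 'm) ring_scheme \<Rightarrow> ('a, 'b, 'c) module_scheme \<Rightarrow> 'a set \<Rightarrow> 'a set"
  where "ratliff_rush R M I =
    (\<Union>k \<in> {k :: nat. 1 \<le> k}.
      colon R M (ideal_smult R M (I [^]\<^bsub>ideals_set R\<^esub> (k + 1)) (carrier M))
                (ideal_smult R M (I [^]\<^bsub>ideals_set R\<^esub> k) (carrier M)))"

end

theory Submission
  imports Defs
begin

text \<open>
  Write \<open>J\<close> for the ideal \<open>r(I, M)\<close>.  The colon ideals \<open>(I\<^sup>k\<^sup>+\<^sup>1M : I\<^sup>kM)\<close>
  increase with \<open>k\<close>, because multiplying both entries of a colon ideal by an ideal can only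
  enlarge it (lemma \<open>colon_subset_colon_ideal_smult\<close>).  As \<open>R\<close> is Noetherian, the chain
  is constant from some \<open>n\<close> on, so \<open>J I\<^sup>kM \<subseteq> I\<^sup>k\<^sup>+\<^sup>1M\<close> for all \<open>k \<ge> n\<close>.  Since
  \<open>I \<subseteq> J\<close>, this is an equality, and iterating it gives \<open>J\<^sup>m I\<^sup>nM = I\<^sup>n\<^sup>+\<^sup>mM\<close> for all \<open>m\<close>.

  Now let \<open>x \<in> r(J, M)\<close>, say \<open>x J\<^sup>mM \<subseteq> J\<^sup>m\<^sup>+\<^sup>1M\<close>.  Multiplication by \<open>I\<^sup>n\<close> turns
  this into \<open>x I\<^sup>n\<^sup>+\<^sup>mM \<subseteq> I\<^sup>n\<^sup>+\<^sup>m\<^sup>+\<^sup>1M\<close>, so \<open>x \<in> J\<close>.  The other inclusion is the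
  observation that every ideal \<open>K\<close> is contained in \<open>r(K, M)\<close>, since \<open>K (K M) \<subseteq> K\<^sup>2M\<close>.

  The module products \<open>I N\<close> are handled through the adjunction
  \<open>I N \<subseteq> P \<longleftrightarrow> I \<subseteq> (P : N)\<close>.  In particular \<open>(I J) N = I (J N)\<close> holds because
  both sides lie in the same submodules.
\<close>

section \<open>Products of ideals with submodules\<close>

lemma carrier_ideals_set [simp]: "carrier (ideals_set R) = {I. ideal I R}"
  and mult_ideals_set [simp]: "I \<otimes>\<^bsub>ideals_set R\<^esub> J = I \<cdot>\<^bsub>R\<^esub> J"
  by (simp_all add: ideals_set_def)

lemma (in ring) ideal_prod_subset_iff:
  assumes "ideal K R"
  shows "I \<cdot> J \<subseteq> K \<longleftrightarrow> (\<forall>i\<in>I. \<forall>j\<in>J. i \<otimes> j \<in> K)"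
proof
  assume "I \<cdot> J \<subseteq> K"
  then show "\<forall>i\<in>I. \<forall>j\<in>J. i \<otimes> j \<in> K"
    by (meson ideal_prod.prod subsetD)
next
  assume *: "\<forall>i\<in>I. \<forall>j\<in>J. i \<otimes> j \<in> K"
  show "I \<cdot> J \<subseteq> K"
  proof
    fix s assume "s \<in> I \<cdot> J"
    then show "s \<in> K"
    proof induct
      case (prod i j)
      then show ?case using * by blast
    next
      case (sum s t)
      then show ?case
        using additive_subgroup.a_closed[OF ideal.axioms(1)[OF assms]] by blast
    qed
  qed
qed

context module
begin

lemma gen_submodule_minimal:
  "submodule N R M \<Longrightarrow> S \<subseteq> N \<Longrightarrow> gen_submodule R M S \<subseteq> N"
  unfolding gen_submodule_def by blast

lemma subset_gen_submodule: "S \<subseteq> gen_submodule R M S"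
  unfolding gen_submodule_def by blast

lemma submodule_zero_closed: "submodule N R M \<Longrightarrow> \<zero>\<^bsub>M\<^esub> \<in> N"
  using subgroup.one_closed[OF submodule.axioms(1)] by force

lemma gen_submodule_is_submodule:
  assumes "S \<subseteq> carrier M"
  shows "submodule (gen_submodule R M S) R M"
proof (rule submoduleI)
  show "gen_submodule R M S \<subseteq> carrier M"
    using gen_submodule_minimal[OF carrier_is_submodule assms] .
qed (auto simp: gen_submodule_def submoduleE submodule_zero_closed)

lemma ideal_smult_is_submodule:
  assumes "I \<subseteq> carrier R" "N \<subseteq> carrier M"
  shows "submodule (ideal_smult R M I N) R M"
  unfolding ideal_smult_def
  by (rule gen_submodule_is_submodule) (use assms in blast)

lemma smult_in_ideal_smult:
  "a \<in> I \<Longrightarrow> x \<in> N \<Longrightarrow> a \<odot>\<^bsub>M\<^esub> x \<in> ideal_smult R M I N"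
  unfolding ideal_smult_def using subset_gen_submodule by fast

lemma ideal_smult_subset_iff:
  assumes "submodule P R M"
  shows "ideal_smult R M I N \<subseteq> P \<longleftrightarrow> (\<forall>a\<in>I. \<forall>x\<in>N. a \<odot>\<^bsub>M\<^esub> x \<in> P)"
proof
  assume "ideal_smult R M I N \<subseteq> P"
  then show "\<forall>a\<in>I. \<forall>x\<in>N. a \<odot>\<^bsub>M\<^esub> x \<in> P"
    using smult_in_ideal_smult by blast
next
  assume "\<forall>a\<in>I. \<forall>x\<in>N. a \<odot>\<^bsub>M\<^esub> x \<in> P"
  then show "ideal_smult R M I N \<subseteq> P"
    unfolding ideal_smult_def by (intro gen_submodule_minimal assms) blast
qed

lemma ideal_smult_subset_iff_subset_colon:
  assumes "submodule P R M" "I \<subseteq> carrier R"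
  shows "ideal_smult R M I N \<subseteq> P \<longleftrightarrow> I \<subseteq> colon R M P N"
  using assms(2) unfolding ideal_smult_subset_iff[OF assms(1)] colon_def by blast

lemma colon_is_ideal:
  assumes P: "submodule P R M" and N: "N \<subseteq> carrier M"
  shows "ideal (colon R M P N) R"
proof (rule idealI)
  show "ring R" by (rule R.ring_axioms)
  show "subgroup (colon R M P N) (add_monoid R)"
  proof (rule R.add.subgroupI)
    have "\<zero> \<in> colon R M P N"
      using N submodule_zero_closed[OF P] by (auto simp: colon_def subset_iff)
    then show "colon R M P N \<noteq> {}" by blast
  next
    fix a assume "a \<in> colon R M P N"
    then show "\<ominus> a \<in> colon R M P N"
      using N submoduleE(3)[OF P] by (auto simp: colon_def subset_iff smult_l_minus)
  next
    fix a b assume "a \<in> colon R M P N" "b \<in> colon R M P N"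
    then show "a \<oplus> b \<in> colon R M P N"
      using N submoduleE(5)[OF P] by (auto simp: colon_def subset_iff smult_l_distr)
  qed (auto simp: colon_def)
next
  fix a x assume ax: "a \<in> colon R M P N" "x \<in> carrier R"
  then show "x \<otimes> a \<in> colon R M P N"
    using N submoduleE(4)[OF P] by (auto simp: colon_def subset_iff smult_assoc1)
  with ax show "a \<otimes> x \<in> colon R M P N"
    using R.m_comm by (simp add: colon_def)
qed

lemma submodule_smult_vimage:
  assumes P: "submodule P R M" and a: "a \<in> carrier R"
  shows "submodule {x \<in> carrier M. a \<odot>\<^bsub>M\<^esub> x \<in> P} R M"
proof (rule submoduleI)
  fix b x assume b: "b \<in> carrier R" and x: "x \<in> {x \<in> carrier M. a \<odot>\<^bsub>M\<^esub> x \<in> P}"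
  have "a \<odot>\<^bsub>M\<^esub> (b \<odot>\<^bsub>M\<^esub> x) = b \<odot>\<^bsub>M\<^esub> (a \<odot>\<^bsub>M\<^esub> x)"
    using a b x by (simp add: smult_assoc1[symmetric] R.m_comm)
  then show "b \<odot>\<^bsub>M\<^esub> x \<in> {x \<in> carrier M. a \<odot>\<^bsub>M\<^esub> x \<in> P}"
    using b x submoduleE(4)[OF P] by auto
qed (use a submoduleE[OF P] submodule_zero_closed[OF P]
      in \<open>auto simp: smult_r_minus smult_r_distr\<close>)

text \<open>
  A submodule \<open>P\<close> contains either side exactly when it contains every \<open>i j x\<close>: for the left
  side because \<open>(P : N)\<close> is an ideal, for the right side because the elements carried into
  \<open>P\<close> by \<open>i\<close> form a submodule.
\<close>

lemma ideal_smult_ideal_prod: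
  assumes I: "ideal I R" and J: "ideal J R" and N: "N \<subseteq> carrier M"
  shows "ideal_smult R M (I \<cdot> J) N = ideal_smult R M I (ideal_smult R M J N)"
proof -
  note carr = ideal.Icarr[OF I] ideal.Icarr[OF J]
  have IJ: "I \<cdot> J \<subseteq> carrier R"
    using R.ideal_prod_in_carrier[OF I J] .
  have JN: "submodule (ideal_smult R M J N) R M"
    using carr N by (intro ideal_smult_is_submodule) auto
  have L: "submodule (ideal_smult R M (I \<cdot> J) N) R M"
    using IJ N by (rule ideal_smult_is_submodule)
  have S: "submodule (ideal_smult R M I (ideal_smult R M J N)) R M"
    using carr submoduleE(1)[OF JN] by (intro ideal_smult_is_submodule) auto
  have bounds: "ideal_smult R M (I \<cdot> J) N \<subseteq> P \<longleftrightarrow>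
      ideal_smult R M I (ideal_smult R M J N) \<subseteq> P" if P: "submodule P R M" for P
  proof -
    have "ideal_smult R M (I \<cdot> J) N \<subseteq> P \<longleftrightarrow> (\<forall>i\<in>I. \<forall>j\<in>J. i \<otimes> j \<in> colon R M P N)"
      by (simp add: ideal_smult_subset_iff_subset_colon[OF P IJ]
          R.ideal_prod_subset_iff[OF colon_is_ideal[OF P N]])
    also have "\<dots> \<longleftrightarrow> (\<forall>i\<in>I. \<forall>j\<in>J. \<forall>x\<in>N. j \<odot>\<^bsub>M\<^esub> x \<in> {y \<in> carrier M. i \<odot>\<^bsub>M\<^esub> y \<in> P})"
      using carr N by (auto simp: colon_def subset_iff smult_assoc1)
    also have "\<dots> \<longleftrightarrow> (\<forall>i\<in>I. ideal_smult R M J N \<subseteq> {y \<in> carrier M. i \<odot>\<^bsub>M\<^esub> y \<in> P})"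
      by (simp add: ideal_smult_subset_iff[OF submodule_smult_vimage[OF P]] carr)
    also have "\<dots> \<longleftrightarrow> ideal_smult R M I (ideal_smult R M J N) \<subseteq> P"
      using submoduleE(1)[OF JN] by (auto simp: ideal_smult_subset_iff[OF P])
    finally show ?thesis .
  qed
  show ?thesis
    using bounds[OF L] bounds[OF S] by blast
qed

text \<open>
  Multiplication by \<open>x\<close> commutes with the action of \<open>K\<close>, so \<open>x B \<subseteq> A\<close> gives
  \<open>x (K B) = K (x B) \<subseteq> K A\<close>.  With \<open>K = I\<close> this makes the colon ideals ascend, and
  with \<open>K = I\<^sup>n\<close> it transports a relation between powers of \<open>J\<close> to one between
  powers of \<open>I\<close>.
\<close>

lemma colon_subset_colon_ideal_smult:
  assumes K: "K \<subseteq> carrier R" and A: "A \<subseteq> carrier M" and B: "B \<subseteq> carrier M"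
  shows "colon R M A B \<subseteq> colon R M (ideal_smult R M K A) (ideal_smult R M K B)"
proof
  fix x assume x: "x \<in> colon R M A B"
  then have xR: "x \<in> carrier R" by (simp add: colon_def)
  note V = submodule_smult_vimage[OF ideal_smult_is_submodule[OF K A] xR]
  have "ideal_smult R M K B \<subseteq> {y \<in> carrier M. x \<odot>\<^bsub>M\<^esub> y \<in> ideal_smult R M K A}"
  proof (subst ideal_smult_subset_iff[OF V], intro ballI)
    fix a b assume ab: "a \<in> K" "b \<in> B"
    have "x \<odot>\<^bsub>M\<^esub> (a \<odot>\<^bsub>M\<^esub> b) = a \<odot>\<^bsub>M\<^esub> (x \<odot>\<^bsub>M\<^esub> b)"
      using ab K B xR by (simp add: subset_iff smult_assoc1[symmetric] R.m_comm)
    moreover have "a \<odot>\<^bsub>M\<^esub> (x \<odot>\<^bsub>M\<^esub> b) \<in> ideal_smult R M K A"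
      using x ab by (auto simp: colon_def intro: smult_in_ideal_smult)
    ultimately show "a \<odot>\<^bsub>M\<^esub> b \<in> {y \<in> carrier M. x \<odot>\<^bsub>M\<^esub> y \<in> ideal_smult R M K A}"
      using ab K B by auto
  qed
  then show "x \<in> colon R M (ideal_smult R M K A) (ideal_smult R M K B)"
    using xR by (auto simp: colon_def)
qed

section \<open>The chain of colon ideals of successive powers\<close>

lemma ideal_pow_is_ideal: "ideal I R \<Longrightarrow> ideal (I [^]\<^bsub>ideals_set R\<^esub> (k::nat)) R"
  using monoid.nat_pow_closed[OF comm_monoid.axioms(1)[OF R.ideals_set_is_comm_monoid]] by simp

lemma ideal_smult_carrier_submodule:
  "ideal I R \<Longrightarrow> submodule (ideal_smult R M I (carrier M)) R M"
  by (intro ideal_smult_is_submodule) (auto dest: ideal.Icarr)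

lemma ideal_smult_pow_Suc:
  assumes "ideal I R"
  shows "ideal_smult R M (I [^]\<^bsub>ideals_set R\<^esub> Suc k) (carrier M) =
    ideal_smult R M I (ideal_smult R M (I [^]\<^bsub>ideals_set R\<^esub> k) (carrier M))"
proof -
  have "I [^]\<^bsub>ideals_set R\<^esub> Suc k = I \<cdot> (I [^]\<^bsub>ideals_set R\<^esub> k)"
    using R.ideal_prod_commute[OF assms ideal_pow_is_ideal[OF assms]] by simp
  then show ?thesis
    by (simp add: ideal_smult_ideal_prod assms ideal_pow_is_ideal)
qed

abbreviation pow_colon :: "'a set \<Rightarrow> nat \<Rightarrow> 'a set" where
  "pow_colon I k \<equiv> colon R M (ideal_smult R M (I [^]\<^bsub>ideals_set R\<^esub> Suc k) (carrier M))
                              (ideal_smult R M (I [^]\<^bsub>ideals_set R\<^esub> k) (carrier M))"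

lemma ratliff_rush_eq_Union_pow_colon: "ratliff_rush R M I = (\<Union>k\<in>{1..}. pow_colon I k)"
  unfolding ratliff_rush_def Suc_eq_plus1 atLeast_def by (rule refl)

lemma pow_colon_is_ideal: "ideal I R \<Longrightarrow> ideal (pow_colon I k) R"
  by (intro colon_is_ideal submoduleE(1) ideal_smult_carrier_submodule ideal_pow_is_ideal)

lemma pow_colon_mono:
  assumes I: "ideal I R" and "k \<le> l"
  shows "pow_colon I k \<subseteq> pow_colon I l"
proof (rule lift_Suc_mono_le[OF _ \<open>k \<le> l\<close>])
  fix k
  note carr = submoduleE(1)[OF ideal_smult_carrier_submodule[OF ideal_pow_is_ideal[OF I]]]
  have "I \<subseteq> carrier R"
    using ideal.Icarr[OF I] by blast
  from colon_subset_colon_ideal_smult[OF this carr carr]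
  show "pow_colon I k \<subseteq> pow_colon I (Suc k)"
    unfolding ideal_smult_pow_Suc[OF I, symmetric] .
qed

lemma subset_pow_colon:
  assumes I: "ideal I R"
  shows "I \<subseteq> pow_colon I k"
proof -
  have "I \<subseteq> carrier R"
    using ideal.Icarr[OF I] by blast
  note ideal_smult_subset_iff_subset_colon[OF
      ideal_smult_carrier_submodule[OF ideal_pow_is_ideal[OF I]] this]
  then show ?thesis
    using equalityD1[OF ideal_smult_pow_Suc[OF I, of k, symmetric]] by blast
qed

lemma subset_ratliff_rush: "ideal I R \<Longrightarrow> I \<subseteq> ratliff_rush R M I"
  unfolding ratliff_rush_eq_Union_pow_colon using subset_pow_colon by fastforce

text \<open>
  One exponent serves all elements of \<open>r(I, M)\<close>; this also shows that \<open>r(I, M)\<close> is an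
  ideal, so that its powers are meaningful.
\<close>

lemma ratliff_rush_stable:
  assumes "noetherian_ring R" and I: "ideal I R"
  obtains n where "1 \<le> n" "ratliff_rush R M I = pow_colon I n"
proof -
  have "\<Union> (pow_colon I ` {1..}) \<in> pow_colon I ` {1..}"
  proof (rule noetherian_ring.ideal_chain_is_trivial[OF assms(1)])
    show "subset.chain {I. ideal I R} (pow_colon I ` {1..})"
      unfolding subset_chain_def
    proof (intro conjI ballI)
      show "pow_colon I ` {1..} \<subseteq> {I. ideal I R}"
        using pow_colon_is_ideal[OF I] by blast
      fix A B assume "A \<in> pow_colon I ` {1..}" "B \<in> pow_colon I ` {1..}"
      then obtain k l where "A = pow_colon I k" "B = pow_colon I l" by blast
      then show "A \<subseteq> B \<or> B \<subseteq> A"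
        using pow_colon_mono[OF I, of k l] pow_colon_mono[OF I, of l k] nat_le_linear[of k l]
        by fast
    qed
  qed simp
  then show ?thesis
    using that unfolding ratliff_rush_eq_Union_pow_colon by auto
qed

section \<open>Trading powers of the Ratliff-Rush ideal for powers of the ideal\<close>

lemma ideal_smult_mono:
  assumes "I \<subseteq> J" "J \<subseteq> carrier R" "N \<subseteq> carrier M"
  shows "ideal_smult R M I N \<subseteq> ideal_smult R M J N"
  using assms
  by (subst ideal_smult_subset_iff) (auto intro: ideal_smult_is_submodule smult_in_ideal_smult)

text \<open>
  The inclusions \<open>I \<subseteq> J \<subseteq> (I\<^sup>n\<^sup>+\<^sup>1M : I\<^sup>nM)\<close> say that \<open>J\<close> acts on the submodules \<open>I\<^sup>kM\<close> with \<open>k \<ge> n\<close> exactly as \<open>I\<close> does, so \<open>m\<close> factors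
  \<open>J\<close> can be traded for \<open>m\<close> factors \<open>I\<close> one after the other.
\<close>

lemma ideal_smult_pow_exchange:
  assumes I: "ideal I R" and J: "ideal J R" and "I \<subseteq> J" and Jn: "J \<subseteq> pow_colon I n"
  shows "ideal_smult R M ((J [^]\<^bsub>ideals_set R\<^esub> m) \<cdot> (I [^]\<^bsub>ideals_set R\<^esub> n)) (carrier M) =
    ideal_smult R M (I [^]\<^bsub>ideals_set R\<^esub> (n + m)) (carrier M)"
proof -
  interpret ideals: comm_monoid "ideals_set R"
    by (rule R.ideals_set_is_comm_monoid)
  note pows = ideal_pow_is_ideal[OF I] ideal_pow_is_ideal[OF J]
  have JR: "J \<subseteq> carrier R"
    using ideal.Icarr[OF J] by blast
  (* The colon ideals ascend, so the bound on J at exponent n holds at every n + m. *)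
  have step: "ideal_smult R M J (ideal_smult R M (I [^]\<^bsub>ideals_set R\<^esub> (n + m)) (carrier M)) =
    ideal_smult R M (I [^]\<^bsub>ideals_set R\<^esub> Suc (n + m)) (carrier M)" for m
  proof
    have "J \<subseteq> pow_colon I (n + m)"
      using Jn pow_colon_mono[OF I, of n "n + m"] by simp
    then show "ideal_smult R M J (ideal_smult R M (I [^]\<^bsub>ideals_set R\<^esub> (n + m)) (carrier M)) \<subseteq>
      ideal_smult R M (I [^]\<^bsub>ideals_set R\<^esub> Suc (n + m)) (carrier M)"
      using ideal_smult_subset_iff_subset_colon[OF
          ideal_smult_carrier_submodule[OF ideal_pow_is_ideal[OF I]] JR] by blast
    show "ideal_smult R M (I [^]\<^bsub>ideals_set R\<^esub> Suc (n + m)) (carrier M) \<subseteq>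
      ideal_smult R M J (ideal_smult R M (I [^]\<^bsub>ideals_set R\<^esub> (n + m)) (carrier M))"
      unfolding ideal_smult_pow_Suc[OF I]
      by (intro ideal_smult_mono \<open>I \<subseteq> J\<close> JR submoduleE(1) ideal_smult_carrier_submodule pows)
  qed
  show ?thesis
  proof (induction m)
    case 0
    have "(J [^]\<^bsub>ideals_set R\<^esub> (0::nat)) \<cdot> (I [^]\<^bsub>ideals_set R\<^esub> n) = I [^]\<^bsub>ideals_set R\<^esub> n"
      using ideals.l_one[of "I [^]\<^bsub>ideals_set R\<^esub> n"] pows by simp
    then show ?case by simp
  next
    case (Suc m)
    have "(J [^]\<^bsub>ideals_set R\<^esub> Suc m) \<cdot> (I [^]\<^bsub>ideals_set R\<^esub> n) =
        J \<cdot> ((J [^]\<^bsub>ideals_set R\<^esub> m) \<cdot> (I [^]\<^bsub>ideals_set R\<^esub> n))"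
      using R.ideal_prod_commute[OF J pows(2)] R.ideal_prod_assoc[OF J pows(2) pows(1)] by simp
    then have "ideal_smult R M ((J [^]\<^bsub>ideals_set R\<^esub> Suc m) \<cdot> (I [^]\<^bsub>ideals_set R\<^esub> n)) (carrier M) =
        ideal_smult R M J (ideal_smult R M (I [^]\<^bsub>ideals_set R\<^esub> (n + m)) (carrier M))"
      using Suc.IH ideal_smult_ideal_prod[OF J R.ideal_prod_is_ideal[OF pows(2) pows(1)]]
      by (simp del: nat_pow_Suc)
    then show ?case
      by (simp only: step add_Suc_right)
  qed
qed

text \<open>
  After multiplication by \<open>I\<^sup>n\<close>, the submodules \<open>J\<^sup>mM\<close> and \<open>J\<^sup>m\<^sup>+\<^sup>1M\<close> become
  \<open>I\<^sup>n\<^sup>+\<^sup>mM\<close> and \<open>I\<^sup>n\<^sup>+\<^sup>m\<^sup>+\<^sup>1M\<close>, while multipliers between them remain multipliers.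
\<close>

lemma pow_colon_subset_of_exchange:
  assumes I: "ideal I R" and J: "ideal J R" and "I \<subseteq> J" and Jn: "J \<subseteq> pow_colon I n"
  shows "pow_colon J m \<subseteq> pow_colon I (n + m)"
proof -
  note pows = ideal_pow_is_ideal[OF I] ideal_pow_is_ideal[OF J]
  note carr = submoduleE(1)[OF ideal_smult_carrier_submodule[OF ideal_pow_is_ideal[OF J]]]
  have In: "I [^]\<^bsub>ideals_set R\<^esub> n \<subseteq> carrier R"
    using ideal.Icarr[OF pows(1)] by blast
  have exchange: "ideal_smult R M (I [^]\<^bsub>ideals_set R\<^esub> n)
      (ideal_smult R M (J [^]\<^bsub>ideals_set R\<^esub> k) (carrier M)) =
      ideal_smult R M (I [^]\<^bsub>ideals_set R\<^esub> (n + k)) (carrier M)" for k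
    using ideal_smult_pow_exchange[OF assms, of k]
    by (simp add: ideal_smult_ideal_prod[symmetric] pows R.ideal_prod_commute[OF pows(1) pows(2)])
  show ?thesis
    using colon_subset_colon_ideal_smult[OF In carr carr, of "Suc m" m]
    unfolding exchange add_Suc_right .
qed

end

theorem theorem3p3:
  fixes R :: "('a, 'm) ring_scheme" and M :: "('a, 'b, 'c) module_scheme"
    and I :: "'a set"
  assumes "cring R" and "noetherian_ring R"
    and "module R M" and "finitely_generated_module R M"
    and "ideal I R"
  shows "ratliff_rush R M (ratliff_rush R M I) = ratliff_rush R M I"
proof -
  interpret module R M by fact
  obtain n where n: "1 \<le> n" "ratliff_rush R M I = pow_colon I n"
    using ratliff_rush_stable[OF assms(2,5)] .
  define J where "J = ratliff_rush R M I"
  have J: "ideal J R"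
    unfolding J_def n(2) by (rule pow_colon_is_ideal[OF assms(5)])
  have "I \<subseteq> J"
    unfolding J_def by (rule subset_ratliff_rush[OF assms(5)])
  have "pow_colon J m \<subseteq> J" for m
  proof -
    have "pow_colon J m \<subseteq> pow_colon I (n + m)"
      using pow_colon_subset_of_exchange[OF assms(5) J \<open>I \<subseteq> J\<close>] n(2) J_def by blast
    also have "\<dots> \<subseteq> J"
      using n(1) unfolding J_def ratliff_rush_eq_Union_pow_colon by (intro UN_upper) simp
    finally show ?thesis .
  qed
  then have "ratliff_rush R M J \<subseteq> J"
    unfolding ratliff_rush_eq_Union_pow_colon[of J] by blast
  with subset_ratliff_rush[OF J] show ?thesis
    unfolding J_def[symmetric] by blast
qed

end
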